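(* Let $a_1,\dots,a_n$ be positive integers with $\gcd(a_1,\dots,a_n)=1$, $m=\sum_i a_i$, $P=(a_1/m,\dots,a_n/m)$, $k=\lceil\log m\rceil$, and $a_0=2^k-m$. For every integer $K\ge k$, with $c_K=\lfloor 2^K/m\rfloor$, $$\mathbb{E}[C(\mathrm{ALDR}[P,K])]\le\mathbb{E}[C(\mathrm{FLDR}[P])],$$ with equality if and only if none of the multiplications $c_K\times a_i$ ($i=0,1,\dots,n$) carries.
   Context: All logarithms are base 2. For real $x\ge0$ and integer $d$, $\epsilon_d(x)=\lfloor2^dx\rfloor\bmod2$, $\nu(x)=\sum_dd\,\epsilon_d(x)2^{-d}$. A DDG tree is a sampler driven by i.i.d. fair bits: a binary tree (possibly with back edges to the root) with labeled leaves traversed from the root one fair bit per step until a leaf is reached, whose label is output; $C(T)$ is the number of bits consumed. FLDR: for positive integers $A_1,\dots,A_n$ with sum $M$, $K'=\lceil\log M\rceil$, $A_0=2^{K'}-M$, $Q=(A_0/2^{K'},\dots,A_n/2^{K'})$; $\mathrm{FLDR}[A_1,\dots,A_n]$ is an entropy-optimal DDG tree for $Q$ (exactly $\epsilon_d(A_i/2^{K'})$ leaves labeled $i$ at depth $d$) with every leaf labeled $0$ replaced by a back edge to the root; its output distribution is $(A_i/M)$ and $\mathbb{E}[C]=(2^{K'}/M)\sum_{i=0}^n\nu(A_i/2^{K'})$. ALDR: $\mathrm{ALDR}[P,K]=\mathrm{FLDR}[c_Ka_1,\dots,c_Ka_n]$, and $\mathrm{FLDR}[P]=\mathrm{FLDR}[a_1,\dots,a_n]$.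 Carries: for nonnegative integers $x=\sum_jx_j2^j$, $y=\sum_jy_j2^j$ (binary digits $x_j,y_j\in\{0,1\}$), the multiplication $x\times y$ does not carry iff the binary digits of $xy$ equal the coefficients of the polynomial product $(\sum_jx_jz^j)(\sum_jy_jz^j)$, i.e., iff $\sum_j x_jy_{d-j}\in\{0,1\}$ for every $d$; otherwise it carries. *)

theory Defs
  imports "HOL-Probability.Probability"
begin

datatype ddg = Leaf nat | Back | Node ddg ddg

fun is_leaf :: "ddg \<Rightarrow> bool" where
  "is_leaf (Leaf _) = True"
| "is_leaf _ = False"

fun leaf_count :: "ddg \<Rightarrow> nat \<Rightarrow> nat \<Rightarrow> nat" where
  "leaf_count (Leaf j) i d = (if i = j \<and> d = 0 then 1 else 0)"
| "leaf_count Back i d = 0"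
| "leaf_count (Node l r) i 0 = 0"
| "leaf_count (Node l r) i (Suc d) = leaf_count l i d + leaf_count r i d"

fun no_back :: "ddg \<Rightarrow> bool" where
  "no_back (Leaf _) = True"
| "no_back Back = False"
| "no_back (Node l r) \<longleftrightarrow> no_back l \<and> no_back r"

text \<open>A back edge is not a node of its own: following an edge that leads to \<^term>\<open>Back\<close> puts the
  walk at the root \<^term>\<open>T\<close>, without an extra bit. Leaves are absorbing.\<close>

fun step :: "ddg \<Rightarrow> ddg \<Rightarrow> bool \<Rightarrow> ddg" where
  "step T (Node l r) b = (let t = (if b then r else l) in if t = Back then T else t)"
| "step T t b = t"

text \<open>The infimum is \<^term>\<open>\<infinity>\<close> on bit streams on which the walk never reaches a leaf.\<close>

definition bits_consumed :: "ddg \<Rightarrow> bool stream \<Rightarrow> enat" where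
  "bits_consumed T \<omega> = (INF j \<in> {j. is_leaf (foldl (step T) T (stake j \<omega>))}. enat j)"

definition fair_bits :: "bool stream measure" where
  "fair_bits = stream_space (measure_pmf (bernoulli_pmf (1/2)))"

definition expected_cost :: "ddg \<Rightarrow> ennreal" where
  "expected_cost T = (\<integral>\<^sup>+ \<omega>. ennreal_of_enat (bits_consumed T \<omega>) \<partial>fair_bits)"

definition eps :: "int \<Rightarrow> real \<Rightarrow> int" where
  "eps d x = \<lfloor>2 powi d * x\<rfloor> mod 2"

text \<open>For a dyadic distribution \<^term>\<open>Q\<close> the trees with these leaf counts are finite, so the finite
  datatype loses nothing.\<close>

definition entropy_optimal :: "(nat \<Rightarrow> real) \<Rightarrow> ddg \<Rightarrow> bool" where
  "entropy_optimal Q T \<longleftrightarrow> no_back T \<and> (\<forall>i d. int (leaf_count T i d) = eps (int d) (Q i))"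

fun reject_to_root :: "ddg \<Rightarrow> ddg" where
  "reject_to_root (Leaf i) = (if i = 0 then Back else Leaf i)"
| "reject_to_root Back = Back"
| "reject_to_root (Node l r) = Node (reject_to_root l) (reject_to_root r)"

definition ceil_log :: "nat \<Rightarrow> nat" where
  "ceil_log M = nat \<lceil>log 2 (real M)\<rceil>"

definition fldr_weight :: "nat \<Rightarrow> (nat \<Rightarrow> nat) \<Rightarrow> nat \<Rightarrow> nat" where
  "fldr_weight n A i =
     (let M = (\<Sum>j=1..n. A j) in
      if i = 0 then 2 ^ ceil_log M - M else if i \<le> n then A i else 0)"

definition fldr_dist :: "nat \<Rightarrow> (nat \<Rightarrow> nat) \<Rightarrow> nat \<Rightarrow> real" where
  "fldr_dist n A i = real (fldr_weight n A i) / 2 ^ ceil_log (\<Sum>j=1..n. A j)"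

text \<open>The leaf counts fix the tree only up to rearranging subtrees, hence predicates rather than
  functions. Only the values \<^term>\<open>A 1\<close>, ..., \<^term>\<open>A n\<close> matter; \<^term>\<open>A 0\<close> is ignored.\<close>

definition is_fldr :: "nat \<Rightarrow> (nat \<Rightarrow> nat) \<Rightarrow> ddg \<Rightarrow> bool" where
  "is_fldr n A T \<longleftrightarrow> (\<exists>T0. entropy_optimal (fldr_dist n A) T0 \<and> T = reject_to_root T0)"

definition is_aldr :: "nat \<Rightarrow> (nat \<Rightarrow> nat) \<Rightarrow> nat \<Rightarrow> ddg \<Rightarrow> bool" where
  "is_aldr n a K T \<longleftrightarrow> is_fldr n (\<lambda>i. (2 ^ K div (\<Sum>j=1..n. a j)) * a i) T"

definition carries :: "nat \<Rightarrow> nat \<Rightarrow> bool" where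
  "carries x y \<longleftrightarrow>
     \<not> (\<forall>d. (of_bool (bit (x * y) d) :: nat) = (\<Sum>j\<le>d. of_bool (bit x j) * of_bool (bit y (d - j))))"


text \<open>Existence of FLDR trees, so that quantifying over all of them is not vacuous.\<close>

lemma pair_up:
  assumes "length us = 2 * M" "\<forall>t\<in>set us. no_back t"
  shows "\<exists>vs. length vs = M \<and> (\<forall>t\<in>set vs. no_back t) \<and>
      (\<forall>i. (\<Sum>t\<leftarrow>vs. leaf_count t i 0) = 0) \<and>
      (\<forall>i d. (\<Sum>t\<leftarrow>vs. leaf_count t i (Suc d)) = (\<Sum>t\<leftarrow>us. leaf_count t i d))"
  using assms
proof (induction M arbitrary: us)
  case 0
  then show ?case by simp
next
  case (Suc M)
  then obtain x y zs where us: "us = x # y # zs" "length zs = 2 * M"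
    by (auto simp: length_Suc_conv)
  with Suc obtain vs where vs: "length vs = M" "\<forall>t\<in>set vs. no_back t"
      "\<forall>i. (\<Sum>t\<leftarrow>vs. leaf_count t i 0) = 0"
      "\<forall>i d. (\<Sum>t\<leftarrow>vs. leaf_count t i (Suc d)) = (\<Sum>t\<leftarrow>zs. leaf_count t i d)"
    by (metis list.set_intros(2))
  show ?case
    by (rule exI[of _ "Node x y # vs"]) (use vs us Suc.prems in auto)
qed

lemma leaf_forest:
  fixes g :: "nat \<Rightarrow> nat"
  shows "\<exists>ls. length ls = (\<Sum>i<n. g i) \<and> (\<forall>t\<in>set ls. no_back t) \<and>
      (\<forall>i d. (\<Sum>t\<leftarrow>ls. leaf_count t i d) = (if i < n \<and> d = 0 then g i else 0))"
proof (induction n)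
  case 0
  then show ?case by simp
next
  case (Suc n)
  then obtain ls where ls: "length ls = (\<Sum>i<n. g i)" "\<forall>t\<in>set ls. no_back t"
      "\<forall>i d. (\<Sum>t\<leftarrow>ls. leaf_count t i d) = (if i < n \<and> d = 0 then g i else 0)"
    by blast
  show ?case
    by (rule exI[of _ "ls @ replicate (g n) (Leaf n)"])
      (use ls in \<open>auto simp: sum_list_replicate less_Suc_eq\<close>)
qed

lemma forest_exists:
  fixes f :: "nat \<Rightarrow> nat \<Rightarrow> nat"
  assumes "(\<Sum>i<n. \<Sum>d\<le>D. f i d * 2 ^ (D - d)) = N * 2 ^ D"
    and "\<And>i d. i \<ge> n \<or> d > D \<Longrightarrow> f i d = 0"
  shows "\<exists>ts. length ts = N \<and> (\<forall>t\<in>set ts. no_back t) \<and>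
      (\<forall>i d. (\<Sum>t\<leftarrow>ts. leaf_count t i d) = f i d)"
  using assms
proof (induction D arbitrary: f N)
  case 0
  obtain ls where ls: "length ls = (\<Sum>i<n. f i 0)" "\<forall>t\<in>set ls. no_back t"
      "\<forall>i d. (\<Sum>t\<leftarrow>ls. leaf_count t i d) = (if i < n \<and> d = 0 then f i 0 else 0)"
    using leaf_forest[where n = n and g = "\<lambda>i. f i 0"] by blast
  show ?case
    by (rule exI[of _ ls]) (use ls 0 in auto)
next
  case (Suc D)
  define n0 where "n0 = (\<Sum>i<n. f i 0)"
  define S where "S = (\<Sum>i<n. \<Sum>d\<le>D. f i (Suc d) * 2 ^ (D - d))"
  have "(\<Sum>i<n. \<Sum>d\<le>Suc D. f i d * 2 ^ (Suc D - d)) = n0 * 2 ^ Suc D + S"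
    by (simp add: sum.atMost_Suc_shift sum.distrib n0_def S_def sum_distrib_right
        del: sum.atMost_Suc power_Suc)
  with Suc.prems have eq: "n0 * 2 ^ Suc D + S = N * 2 ^ Suc D" by simp
  then have "n0 * 2 ^ Suc D \<le> N * 2 ^ Suc D" by linarith
  then have le: "n0 \<le> N" by simp
  have "S = (N - n0) * 2 ^ Suc D"
    using eq by (simp add: diff_mult_distrib del: power_Suc)
  then have "S = (2 * (N - n0)) * 2 ^ D" by simp
  then obtain us where us: "length us = 2 * (N - n0)" "\<forall>t\<in>set us. no_back t"
      "\<forall>i d. (\<Sum>t\<leftarrow>us. leaf_count t i d) = f i (Suc d)"
    using Suc.IH[of "\<lambda>i d. f i (Suc d)" "2 * (N - n0)"] Suc.prems(2) S_def by auto
  obtain vs where vs: "length vs = N - n0" "\<forall>t\<in>set vs. no_back t"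
      "\<forall>i. (\<Sum>t\<leftarrow>vs. leaf_count t i 0) = 0"
      "\<forall>i d. (\<Sum>t\<leftarrow>vs. leaf_count t i (Suc d)) = (\<Sum>t\<leftarrow>us. leaf_count t i d)"
    using pair_up[OF us(1,2)] by blast
  obtain ls where ls: "length ls = n0" "\<forall>t\<in>set ls. no_back t"
      "\<forall>i d. (\<Sum>t\<leftarrow>ls. leaf_count t i d) = (if i < n \<and> d = 0 then f i 0 else 0)"
    using leaf_forest[where n = n and g = "\<lambda>i. f i 0"] n0_def by blast
  have "(\<Sum>t\<leftarrow>ls @ vs. leaf_count t i d) = f i d" for i d
    using ls(3) vs(3,4) us(3) Suc.prems(2) by (cases d) auto
  moreover have "length (ls @ vs) = N" using ls vs le by simp
  moreover have "\<forall>t\<in>set (ls @ vs). no_back t" using ls vs by auto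
  ultimately show ?case by blast
qed

lemma ceil_log_ge:
  assumes "0 < M"
  shows "M \<le> 2 ^ ceil_log M"
proof -
  have "log 2 (real M) \<le> real (ceil_log M)"
    unfolding ceil_log_def by linarith
  then have "real M \<le> 2 powr real (ceil_log M)"
    using assms by (simp add: log_le_iff)
  then have "real M \<le> real (2 ^ ceil_log M)"
    by (simp add: powr_realpow)
  then show ?thesis by (simp only: of_nat_le_iff)
qed

lemma eps_dyadic:
  "eps (int d) (real A / 2 ^ D) = (if d \<le> D then of_bool (bit A (D - d)) else 0)"
proof (cases "d \<le> D")
  case True
  then have "2 ^ d * (real A / 2 ^ D) = real A / 2 ^ (D - d)"
    by (simp add: power_diff)
  also have "\<dots> = real A / real (2 ^ (D - d))" by simp
  finally have "\<lfloor>2 ^ d * (real A / 2 ^ D)\<rfloor> = int (A div 2 ^ (D - d))"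
    by (simp only: floor_divide_of_nat_eq)
  then show ?thesis
    using True by (simp add: eps_def bit_iff_odd mod_2_eq_odd)
next
  case False
  then have "(2::real) ^ d = 2 ^ (d - D) * 2 ^ D"
    by (simp flip: power_add)
  then have "2 ^ d * (real A / 2 ^ D) = real_of_int (int A * 2 ^ (d - D))"
    by simp
  then have "\<lfloor>2 ^ d * (real A / 2 ^ D)\<rfloor> = int A * 2 ^ (d - D)"
    by (simp only: floor_of_int)
  then show ?thesis
    using False by (simp add: eps_def)
qed

lemma digit_sum:
  "(\<Sum>d\<le>D. of_bool (bit A d) * 2 ^ d) = A mod 2 ^ Suc (D::nat)" for A :: nat
proof -
  have "(\<Sum>d<N. of_bool (bit A d) * 2 ^ d) = A mod 2 ^ N" for N
  proof (induction N)
    case (Suc N)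
    then show ?case
      by (simp add: bit_iff_odd mod_mult2_eq mult.commute[of 2] mod_2_eq_odd del: power_Suc add: power_Suc2)
  qed simp
  from this[of "Suc D"] show ?thesis by (simp only: lessThan_Suc_atMost)
qed

lemma is_fldr_exists:
  assumes "0 < (\<Sum>j=1..n. A j)"
  shows "\<exists>T. is_fldr n A T"
proof -
  define M where "M = (\<Sum>j=1..n. A j)"
  define D where "D = ceil_log M"
  define w where "w = fldr_weight n A"
  define f where "f i d = (if d \<le> D then of_bool (bit (w i) (D - d)) else 0 :: nat)" for i d
  have MD: "M \<le> 2 ^ D" using ceil_log_ge assms by (simp add: M_def D_def)
  have w0: "w 0 = 2 ^ D - M" by (simp add: w_def fldr_weight_def M_def D_def Let_def)
  have wi: "w i = A i" if "1 \<le> i" "i \<le> n" for i using that by (simp add: w_def fldr_weight_def)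
  have wn: "w i = 0" if "n < i" for i using that by (simp add: w_def fldr_weight_def)
  have "(\<Sum>i<Suc n. w i) = w 0 + (\<Sum>i=1..n. w i)"
    by (simp only: sum.lessThan_Suc_shift sum.atLeast1_atMost_eq One_nat_def)
  also have "(\<Sum>i=1..n. w i) = M" using wi by (simp add: M_def)
  finally have sumw: "(\<Sum>i<Suc n. w i) = 2 ^ D" using w0 MD by simp
  have "(\<Sum>d\<le>D. f i d * 2 ^ (D - d)) = w i" if "i < Suc n" for i
  proof -
    have "w i \<le> 2 ^ D"
      using sumw that member_le_sum[of i "{..<Suc n}" w] by simp
    then have "w i < 2 ^ Suc D" by (simp add: le_less_trans)
    have "(\<Sum>d\<le>D. f i d * 2 ^ (D - d)) = (\<Sum>d\<le>D. of_bool (bit (w i) (D - d)) * 2 ^ (D - d))"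
      by (rule sum.cong) (auto simp: f_def)
    also have "\<dots> = (\<Sum>d\<le>D. of_bool (bit (w i) d) * 2 ^ d)"
      by (rule sum.reindex_bij_witness[of _ "\<lambda>d. D - d" "\<lambda>d. D - d"]) auto
    also have "\<dots> = w i" using \<open>w i < 2 ^ Suc D\<close> by (simp only: digit_sum mod_less)
    finally show ?thesis .
  qed
  then have "(\<Sum>i<Suc n. \<Sum>d\<le>D. f i d * 2 ^ (D - d)) = 1 * 2 ^ D"
    using sumw by simp
  moreover have "f i d = 0" if "i \<ge> Suc n \<or> d > D" for i d
    using that wn by (auto simp: f_def)
  ultimately obtain ts where ts: "length ts = 1" "\<forall>t\<in>set ts. no_back t"
      "\<forall>i d. (\<Sum>t\<leftarrow>ts. leaf_count t i d) = f i d"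
    using forest_exists[where n = "Suc n" and D = D and f = f and N = 1] by blast
  then obtain T where "ts = [T]" by (auto simp: length_Suc_conv)
  with ts have "no_back T" "\<And>i d. leaf_count T i d = f i d" by auto
  then have "entropy_optimal (fldr_dist n A) T"
    by (auto simp: entropy_optimal_def fldr_dist_def f_def eps_dyadic w_def D_def M_def)
  then show ?thesis by (auto simp: is_fldr_def)
qed

end

theory Submission
  imports Defs "HOL-Computational_Algebra.Polynomial"
begin

text \<open>Let \<open>h(x) = \<Sum>\<^sub>j j x\<^sub>j 2\<^sup>j\<close> for the binary digits \<open>x\<^sub>j\<close> of \<open>x\<close>. Solving the renewal equation at the root,
  an FLDR tree for weights \<open>A\<^sub>1, ..., A\<^sub>n\<close> with sum \<open>M\<close> and total \<open>2\<^sup>K\<close> has expected cost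
  \<open>(K 2\<^sup>K - \<Sum>\<^sub>i h(A\<^sub>i)) / M\<close>, where \<open>i\<close> ranges over \<open>0, ..., n\<close>. Schoolbook multiplication shows
  \<open>h(c x) \<ge> c h(x) + x h(c)\<close>, with equality iff nothing carries. For \<open>c = c\<^sub>K\<close> the numbers \<open>c a\<^sub>0\<close> and
  \<open>2\<^sup>K - c m\<close> differ by \<open>(c - 2\<^bsup>K-k\<^esup>) 2\<^sup>k\<close>, and no carries occur in this sum, so that \<open>c m\<close> times the
  difference of the two costs is exactly \<open>\<Sum>\<^sub>i (h(c a\<^sub>i) - c h(a\<^sub>i) - a\<^sub>i h(c))\<close>.\<close>


section \<open>Digit moments and multiplication\<close>

fun bit_moment :: "nat \<Rightarrow> nat" where
  "bit_moment x = (if x = 0 then 0 else 2 * (bit_moment (x div 2) + x div 2))"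

declare bit_moment.simps [simp del]

lemma bit_moment_0 [simp]: "bit_moment 0 = 0"
  by (simp add: bit_moment.simps)

lemma bit_moment_1 [simp]: "bit_moment (Suc 0) = 0"
  by (simp add: bit_moment.simps)

lemma bit_moment_rec: "bit_moment x = 2 * (bit_moment (x div 2) + x div 2)"
  by (cases "x = 0") (auto simp: bit_moment.simps[of x])

text \<open>Halving lowers the exponent of every surviving digit by one, and the added
  \<open>x div 2\<close> in the recursion restores these units. So \<open>bit_moment\<close> is the
  \<open>h\<close> of the overview.\<close>

lemma bit_moment_eq_sum:
  "x < 2 ^ N \<Longrightarrow> bit_moment x = (\<Sum>j<N. j * of_bool (bit x j) * 2 ^ j)"
proof (induction N arbitrary: x)
  case (Suc N)
  define y where "y = x div 2"
  have y: "y < 2 ^ N"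
    using Suc.prems by (simp add: y_def less_mult_imp_div_less mult.commute)
  have "(\<Sum>j<N. of_bool (bit y j) * 2 ^ j) = y"
    using digit_sum[of y "N - 1"] y by (cases N) (auto simp: lessThan_Suc_atMost)
  moreover have "(\<Sum>j<Suc N. j * of_bool (bit x j) * 2 ^ j)
      = 2 * ((\<Sum>j<N. j * of_bool (bit y j) * 2 ^ j) + (\<Sum>j<N. of_bool (bit y j) * 2 ^ j))"
    unfolding sum.lessThan_Suc_shift sum.distrib[symmetric] sum_distrib_left
    by (simp only: mult_zero_left add_0) (rule sum.cong, simp_all add: y_def bit_Suc)
  ultimately show ?case
    using Suc.IH[OF y] by (simp add: bit_moment_rec[of x] y_def del: sum.lessThan_Suc)
qed simp

text \<open>The digits of \<open>r\<close> lie below position \<open>k\<close> and those of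
  \<open>x\<close> move up by \<open>k\<close>, so the two moments do not interact and each moved
  digit gains \<open>k\<close>.\<close>

lemma bit_moment_shift_add:
  "r < 2 ^ k \<Longrightarrow> bit_moment (x * 2 ^ k + r) = 2 ^ k * (bit_moment x + k * x) + bit_moment r"
proof (induction k arbitrary: r)
  case (Suc k)
  have "(x * 2 ^ Suc k + r) div 2 = x * 2 ^ k + r div 2"
    by (simp add: algebra_simps)
  moreover have "r div 2 < 2 ^ k"
    using Suc.prems by (simp add: less_mult_imp_div_less mult.commute)
  ultimately show ?case
    using Suc.IH[of "r div 2"] bit_moment_rec[of "x * 2 ^ Suc k + r"] bit_moment_rec[of r]
    by (simp only: power_Suc) (simp add: algebra_simps)
qed simp

text \<open>The value of \<open>p\<close> at 2 is a sum of powers of two with multiplicities, and \<open>2 p'(2)\<close> is the same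
  sum weighted by the exponents. Merging two equal powers into their double keeps the former and
  strictly increases the latter; the merging ends at the binary expansion.\<close>

lemma pderiv_le_bit_moment:
  fixes p :: "nat poly"
  shows "2 * poly (pderiv p) 2 \<le> bit_moment (poly p 2) \<and>
    (2 * poly (pderiv p) 2 = bit_moment (poly p 2) \<longleftrightarrow>
      (\<forall>d. coeff p d = of_bool (bit (poly p 2) d)))"
proof (induction "poly p 2" arbitrary: p rule: less_induct)
  case less
  obtain a q where p: "p = pCons a q" by (cases p)
  \<comment> \<open>The \<open>a\<close> copies of 2^0 contain \<open>a div 2\<close> pairs; merging
    these and dividing out one factor 2 adds \<open>a div 2\<close> to the constant coefficient of
    \<open>q\<close>.\<close>
  define q' where "q' = q + [:a div 2:]"
  have v: "poly p 2 = a + 2 * poly q 2" by (simp add: p)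
  have v': "poly q' 2 = poly p 2 div 2" by (simp add: q'_def v)
  have dq: "pderiv q' = pderiv q" by (simp add: q'_def pderiv_add pderiv_pCons)
  have dp: "2 * poly (pderiv p) 2 = 2 * (poly q 2 + 2 * poly (pderiv q) 2)"
    by (simp add: p pderiv_pCons)
  have h: "bit_moment (poly p 2) = 2 * (bit_moment (poly q' 2) + poly q 2 + a div 2)"
    using v' v bit_moment_rec[of "poly p 2"] by simp
  show ?case
  \<comment> \<open>Halving decreases the value only if it is nonzero; at value 0 all the natural
    coefficients vanish.\<close>
  proof (cases "poly p 2 = 0")
    case True
    have "r = 0" if "poly r 2 = 0" for r :: "nat poly"
      using that by (induction r) auto
    with True have "p = 0" by blast
    then show ?thesis by simp
  next
    case False
    then have "poly q' 2 < poly p 2" by (simp add: v')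
    from less[OF this] have IH: "2 * poly (pderiv q) 2 \<le> bit_moment (poly q' 2)"
      "2 * poly (pderiv q) 2 = bit_moment (poly q' 2) \<longleftrightarrow>
        (\<forall>d. coeff q' d = of_bool (bit (poly q' 2) d))"
      by (auto simp: dq)
    \<comment> \<open>The deficit of \<open>p\<close> is twice the sum of \<open>a div 2\<close> and
      the deficit of \<open>q'\<close>, so both must vanish.\<close>
    have "2 * poly (pderiv p) 2 = bit_moment (poly p 2) \<longleftrightarrow>
        a div 2 = 0 \<and> 2 * poly (pderiv q) 2 = bit_moment (poly q' 2)"
      using IH(1) unfolding dp h by presburger
    also have "\<dots> \<longleftrightarrow> (\<forall>d. coeff p d = of_bool (bit (poly p 2) d))" (is "?L \<longleftrightarrow> ?R")
    proof
      assume L: ?L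
      then have "q' = q" "a = 0 \<or> a = 1" by (auto simp: q'_def)
      then have "coeff p d = of_bool (bit (poly p 2) d)" for d
        using L IH(2) v' by (cases d) (auto simp: p bit_Suc bit_0)
      then show ?R by blast
    next
      assume R: ?R
      have "a = of_bool (bit (poly p 2) 0)" using R[rule_format, of 0] by (simp add: p)
      then have "a \<le> 1" by (cases "bit (poly p 2) 0") simp_all
      then have "a div 2 = 0" by simp
      then have "q' = q" by (simp add: q'_def)
      have "coeff q' d = of_bool (bit (poly q' 2) d)" for d
        using R[rule_format, of "Suc d"] unfolding v' by (simp add: p \<open>q' = q\<close> bit_Suc)
      with IH(2) \<open>a div 2 = 0\<close> show ?L by blast
    qed
    finally have "2 * poly (pderiv p) 2 = bit_moment (poly p 2) \<longleftrightarrow>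
        (\<forall>d. coeff p d = of_bool (bit (poly p 2) d))" .
    moreover have "2 * poly (pderiv p) 2 \<le> bit_moment (poly p 2)"
      using IH(1) unfolding dp h by simp
    ultimately show ?thesis by blast
  qed
qed

text \<open>Digits as coefficients meet the equality criterion of
  \<open>pderiv_le_bit_moment\<close>, whence the third property.\<close>

lemma binary_poly_exists:
  fixes x :: nat
  obtains p where "\<And>d. coeff p d = of_bool (bit x d)" "poly p 2 = x"
    "2 * poly (pderiv p) 2 = bit_moment x"
proof -
  have "\<exists>p. (\<forall>d. coeff p d = of_bool (bit x d)) \<and> poly p 2 = x"
  proof (induction x rule: less_induct)
    case (less x)
    show ?case
    proof (cases "x = 0")
      case True
      then show ?thesis by (intro exI[of _ 0]) auto
    next
      case False
      then obtain p where "\<forall>d. coeff p d = of_bool (bit (x div 2) d)" "poly p 2 = x div 2"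
        using less[of "x div 2"] by auto
      then show ?thesis
        by (intro exI[of _ "pCons (x mod 2) p"])
          (auto simp: coeff_pCons bit_Suc bit_0 mod_2_eq_odd split: nat.split)
    qed
  qed
  then show ?thesis
    using that pderiv_le_bit_moment by metis
qed

text \<open>By the product rule, the left side is twice the derivative at 2 of the product of the
  two digit polynomials, whose value there is \<open>c * x\<close>. Its coefficients are the digit
  convolutions in \<open>carries\<close>.\<close>

lemma bit_moment_mult:
  "c * bit_moment x + x * bit_moment c \<le> bit_moment (c * x)" (is ?le)
  "c * bit_moment x + x * bit_moment c = bit_moment (c * x) \<longleftrightarrow> \<not> carries c x" (is ?eq)
proof -
  obtain p where p: "\<And>d. coeff p d = of_bool (bit c d)" "poly p 2 = c"
    "2 * poly (pderiv p) 2 = bit_moment c" using binary_poly_exists by blast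
  obtain q where q: "\<And>d. coeff q d = of_bool (bit x d)" "poly q 2 = x"
    "2 * poly (pderiv q) 2 = bit_moment x" using binary_poly_exists by blast
  have "2 * poly (pderiv (p * q)) 2 = c * bit_moment x + x * bit_moment c"
    by (simp add: pderiv_mult p(2) q(2) flip: p(3) q(3))
  then show ?le ?eq
    using pderiv_le_bit_moment[of "p * q"]
    by (simp_all add: p q coeff_mult carries_def eq_commute)
qed

text \<open>With \<open>r = 2 ^ K mod m\<close> and \<open>c' = c - 2 ^ (K - k)\<close>, the two
  weights are \<open>c' * 2 ^ k + r\<close> and \<open>r\<close>; as \<open>r < 2 ^ k\<close>,
  \<open>bit_moment_shift_add\<close> compares them.\<close>

lemma rejection_weight_bit_moment:
  assumes "0 < m" "m \<le> 2 ^ k" "2 ^ k < 2 * m" "k \<le> K" "c = 2 ^ K div m"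
  shows "2 ^ K * K + bit_moment (c * (2 ^ k - m))
    = 2 ^ k * (bit_moment c + k * c) + bit_moment (2 ^ K - c * m)"
proof -
  define N :: nat where "N = 2 ^ (K - k)"
  define r where "r = 2 ^ K mod m"
  have NK: "2 ^ K = N * 2 ^ k"
    using assms(4) by (simp add: N_def flip: power_add)
  have cm: "c * m + r = N * 2 ^ k" 
    unfolding NK[symmetric] assms(5) r_def by (rule div_mult_mod_eq)
  have r: "r < m" using assms(1) by (simp add: r_def)
  have "N * m \<le> N * 2 ^ k" using assms(2) by simp
  also have "\<dots> < (c + 1) * m" using cm r by simp
  finally have "N < c + 1" by (simp only: mult_less_cancel2)
  then have "N \<le> c" by simp
  have "0 < N" by (simp add: N_def)
  with \<open>N \<le> c\<close> have "c * 2 ^ k < c * (2 * m)" using assms(3) by simp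
  also have "\<dots> \<le> 2 * (N * 2 ^ k)" using cm by simp
  finally have "c < 2 * N" by simp
  \<comment> \<open>The bounds \<open>N <= c < 2 * N\<close> put the leading digit of
    \<open>c\<close> at position \<open>K - k\<close>; \<open>c'\<close> consists of the lower
    digits.\<close>
  define c' where "c' = c - N"
  have c': "c = N + c'" "c' < N" using \<open>N \<le> c\<close> \<open>c < 2 * N\<close> by (auto simp: c'_def)
  have "bit_moment c = N * (K - k) + bit_moment c'"
    using bit_moment_shift_add[of c' "K - k" 1] c' by (simp add: N_def)
  moreover have "c * (2 ^ k - m) = c' * 2 ^ k + r"
    using cm assms(2) c'(1) by (simp add: diff_mult_distrib2 algebra_simps)
  moreover have "bit_moment (c' * 2 ^ k + r) = 2 ^ k * (bit_moment c' + k * c') + bit_moment r"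
    using r assms(2) by (intro bit_moment_shift_add) simp
  moreover have "2 ^ K - c * m = r" using cm NK by simp
  moreover obtain e where "K = k + e" using assms(4) le_Suc_ex by blast
  ultimately show ?thesis
    by (simp add: c'(1) N_def power_add algebra_simps)
qed

section \<open>The walk and its survival probabilities\<close>

lemma foldl_step_leaf: "is_leaf t \<Longrightarrow> foldl (step R) t bs = t"
proof (induction bs)
  case (Cons b bs)
  then show ?case by (cases t) auto
qed simp

lemma is_leaf_step_mono:
  assumes "is_leaf (foldl (step R) t (stake i \<omega>))" "i \<le> j"
  shows "is_leaf (foldl (step R) t (stake j \<omega>))"
proof -
  have "stake j \<omega> = stake i \<omega> @ stake (j - i) (sdrop i \<omega>)"
    using assms(2) by (simp add: stake_add)
  then show ?thesis using assms(1) by (simp only: foldl_append foldl_step_leaf)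
qed

text \<open>Leaves are absorbing, so the number of bits is the number of times at which the walk is
  not yet at a leaf. The expectation thus becomes a series of probabilities.\<close>

lemma bits_consumed_eq_suminf:
  "ennreal_of_enat (bits_consumed T \<omega>)
    = (\<Sum>j. of_bool (\<not> is_leaf (foldl (step T) T (stake j \<omega>))))"
proof -
  define P where "P j \<longleftrightarrow> is_leaf (foldl (step T) T (stake j \<omega>))" for j
  have mono: "P j" if "P i" "i \<le> j" for i j
    using is_leaf_step_mono that unfolding P_def by blast
  have bc: "bits_consumed T \<omega> = (INF j \<in> {j. P j}. enat j)"
    by (simp add: bits_consumed_def P_def)
  have "ennreal_of_enat (bits_consumed T \<omega>) = (\<Sum>j. of_bool (\<not> P j))"
  proof (cases "\<exists>j. P j")
    case True
    define L where "L = (LEAST j. P j)"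
    have L: "P j \<longleftrightarrow> L \<le> j" for j
      using True mono unfolding L_def by (metis LeastI Least_le)
    have "bits_consumed T \<omega> = enat L"
      unfolding bc by (rule INF_eqI) (auto simp: L)
    moreover have "(\<Sum>j. of_bool (\<not> P j) :: ennreal) = (\<Sum>j<L. of_bool (\<not> P j))"
      by (rule suminf_finite) (auto simp: L)
    ultimately show ?thesis by (simp add: L)
  next
    \<comment> \<open>Without a leaf the infimum of the empty set is infinite, and so is the series
      of ones.\<close>
    case False
    have "(\<Sum>j. 1 :: ennreal) = top"
      by (simp add: suminf_eq_SUP ennreal_SUP_of_nat_eq_top)
    with False show ?thesis by (simp add: bc top_enat_def infinity_ennreal_def)
  qed
  then show ?thesis by (simp add: P_def)
qed

text \<open>Probability that the walk on the tree \<open>R\<close>, now at \<open>t\<close>, is not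
  at a leaf after \<open>j\<close> more bits, by conditioning on the next bit.\<close>

fun survival :: "ddg \<Rightarrow> nat \<Rightarrow> ddg \<Rightarrow> real" where
  "survival R 0 t = of_bool (\<not> is_leaf t)"
| "survival R (Suc j) t = (survival R j (step R t False) + survival R j (step R t True)) / 2"

lemma survival_nonneg: "0 \<le> survival R j t"
  by (induction j arbitrary: t) auto

lemma survival_leaf: "is_leaf t \<Longrightarrow> survival R j t = 0"
proof (induction j arbitrary: t)
  case (Suc j)
  then show ?case by (cases t) auto
qed auto

lemma measurable_walk [measurable]:
  "(\<lambda>\<omega>. of_bool (\<not> is_leaf (foldl (step R) t (stake j \<omega>))) :: ennreal) \<in> borel_measurable fair_bits"
proof -
  have st: "stake j \<in> fair_bits \<rightarrow>\<^sub>M count_space UNIV"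
    unfolding fair_bits_def by measurable
  have f: "(\<lambda>bs. of_bool (\<not> is_leaf (foldl (step R) t bs)) :: ennreal) \<in> count_space UNIV \<rightarrow>\<^sub>M borel"
    by simp
  show ?thesis using measurable_compose[OF st f] by simp
qed

text \<open>A fair stream is a fair bit followed by an independent fair stream, which gives the
  recursion of \<open>survival\<close>.\<close>

lemma nn_integral_walk:
  "(\<integral>\<^sup>+\<omega>. of_bool (\<not> is_leaf (foldl (step R) t (stake j \<omega>))) \<partial>fair_bits) = ennreal (survival R j t)"
proof (induction j arbitrary: t)
  case 0
  interpret prob_space fair_bits
    unfolding fair_bits_def by (intro prob_space.prob_space_stream_space prob_space_measure_pmf)
  show ?case by (simp add: emeasure_space_1)
next
  case (Suc j)
  let ?B = "measure_pmf (bernoulli_pmf (1/2))"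
  have "(\<integral>\<^sup>+\<omega>. of_bool (\<not> is_leaf (foldl (step R) t (stake (Suc j) \<omega>))) \<partial>fair_bits)
      = (\<integral>\<^sup>+b. (\<integral>\<^sup>+\<omega>. of_bool (\<not> is_leaf (foldl (step R) t (stake (Suc j) (b ## \<omega>)))) \<partial>fair_bits) \<partial>?B)"
    using measurable_walk[of R t "Suc j"] unfolding fair_bits_def
    by (rule prob_space.nn_integral_stream_space[OF prob_space_measure_pmf])
  also have "\<dots> = (\<integral>\<^sup>+b. ennreal (survival R j (step R t b)) \<partial>?B)"
    by (simp add: Suc)
  also have "\<dots> = ennreal (survival R (Suc j) t)"
    by (simp add: survival_nonneg add_divide_distrib ennreal_plus divide_ennreal[symmetric]
        divide_ennreal_def add.commute)
  finally show ?case .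
qed

lemma expected_cost_eq_suminf: "expected_cost T = (\<Sum>j. ennreal (survival T j T))"
  unfolding expected_cost_def bits_consumed_eq_suminf
  by (subst nn_integral_suminf) (simp_all add: nn_integral_walk)

section \<open>One descent, and the renewal equation at the root\<close>

fun mean_depth :: "ddg \<Rightarrow> real" where
  "mean_depth (Node l r) = 1 + (mean_depth l + mean_depth r) / 2"
| "mean_depth t = 0"

text \<open>In a tree without back edges, the probability that one descent ends at label
  \<open>i\<close>; \<open>mean_depth\<close> is the expected number of bits of that
  descent.\<close>

fun label_mass :: "nat \<Rightarrow> ddg \<Rightarrow> real" where
  "label_mass i (Leaf j) = of_bool (i = j)"
| "label_mass i Back = 0"
| "label_mass i (Node l r) = (label_mass i l + label_mass i r) / 2"

lemma mean_depth_nonneg: "0 \<le> mean_depth t"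
  by (induction t) auto

lemma label_mass_nonneg: "0 \<le> label_mass i t"
  by (induction t) auto

text \<open>A rejected descent resumes at the root without an extra bit, so the cost satisfies
  \<open>g = mean_depth T0 + label_mass 0 T0 * g\<close>. Infinity would satisfy it too if
  \<open>label_mass 0 T0\<close> is positive, so the partial sums are first bounded by means of the
  finite solution.\<close>

lemma expected_cost_reject_to_root:
  assumes "no_back T0" and "label_mass 0 T0 < 1"
  shows "expected_cost (reject_to_root T0) = ennreal (mean_depth T0 / (1 - label_mass 0 T0))"
proof -
  define R where "R = reject_to_root T0"
  define g where "g = mean_depth T0 / (1 - label_mass 0 T0)"
  \<comment> \<open>\<open>s t\<close> is the state of the walk on entering the subtree
    \<open>t\<close> of \<open>T0\<close>; a rejected leaf stands for the root.\<close>
  define s where "s t = (if reject_to_root t = Back then R else reject_to_root t)" for t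
  define H where "H N t = (\<Sum>j<N. survival R j (s t))" for N t
  have g: "g = mean_depth T0 + label_mass 0 T0 * g"
    using assms(2) by (simp add: g_def field_simps)
  have back_iff: "reject_to_root t = Back \<longleftrightarrow> t = Leaf 0" if "no_back t" for t
    using that by (cases t) auto
  have T0: "T0 \<noteq> Leaf 0" using assms(2) by auto
  then have sT0: "s T0 = R" using assms(1) by (simp add: s_def R_def)
  have s0: "s (Leaf 0) = R" by (simp add: s_def)
  have s_leaf: "is_leaf (s (Leaf i))" if "i \<noteq> 0" for i using that by (simp add: s_def)
  have s_Node: "\<not> is_leaf (s (Node l r))" "step R (s (Node l r)) b = s (if b then r else l)" for l r b
    by (auto simp: s_def)
  have H_Suc: "H (Suc N) (Node l r) = 1 + (H N l + H N r) / 2" for N l r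
    unfolding H_def sum.lessThan_Suc_shift
    by (simp add: s_Node sum_divide_distrib[symmetric] sum.distrib)
  have H_leaf: "H N (Leaf i) = 0" if "i \<noteq> 0" for N i
    using s_leaf[OF that] by (simp add: H_def survival_leaf)
  have bound: "H N t \<le> mean_depth t + label_mass 0 t * g" if "no_back t" for N t
    using that
  proof (induction N arbitrary: t)
    case 0
    have "0 \<le> g" using assms(2) by (simp add: g_def mean_depth_nonneg)
    then show ?case by (simp add: H_def mean_depth_nonneg label_mass_nonneg)
  next
    case (Suc N)
    \<comment> \<open>Entering \<open>Leaf 0\<close> uses no bit and leads to \<open>T0\<close> at
      the same \<open>N\<close>, so the other trees, \<open>T0\<close> among them, come
      first.\<close>
    have *: "H (Suc N) u \<le> mean_depth u + label_mass 0 u * g" if "no_back u" "u \<noteq> Leaf 0" for u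
    proof (cases u)
      case (Node l r)
      with Suc.IH[of l] Suc.IH[of r] that show ?thesis by (simp add: H_Suc field_simps)
    qed (use that in \<open>auto simp: H_leaf\<close>)
    show ?case
    proof (cases "t = Leaf 0")
      case True
      then have "H (Suc N) t = H (Suc N) T0" by (simp add: H_def s0 sT0)
      also have "\<dots> \<le> g" using *[OF assms(1) T0] g by simp
      finally show ?thesis using True by simp
    qed (use * Suc.prems in auto)
  qed
  have sm: "summable (\<lambda>j. survival R j (s t))" if "no_back t" for t
    using bound[OF that] unfolding H_def
    by (intro summableI_nonneg_bounded) (auto simp: survival_nonneg)
  define G where "G t = (\<Sum>j. survival R j (s t))" for t
  \<comment> \<open>Convergence turns the same recursion into an identity between finite numbers,
    which can be solved for \<open>G T0\<close>.\<close>
  have G: "G t = mean_depth t + label_mass 0 t * G T0" if "no_back t" for t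
    using that
  proof (induction t)
    case (Leaf i)
    show ?case
      by (cases "i = 0") (auto simp: G_def s0 sT0 survival_leaf[OF s_leaf])
  next
    case (Node l r)
    have "G (Node l r) = (\<Sum>j. survival R (Suc j) (s (Node l r))) + 1"
      unfolding G_def by (subst suminf_split_head[OF sm[OF Node.prems]]) (simp add: s_Node)
    also have "(\<Sum>j. survival R (Suc j) (s (Node l r))) = (G l + G r) / 2"
      using Node.prems sm unfolding G_def
      by (simp add: s_Node suminf_divide suminf_add summable_add)
    finally show ?case using Node by (simp add: field_simps)
  qed simp
  have "G T0 = g"
    using G[OF assms(1)] assms(2) by (simp add: g_def field_simps)
  moreover have "expected_cost R = ennreal (G T0)"
    using suminf_ennreal2[OF survival_nonneg sm[OF assms(1)]]
    by (simp add: expected_cost_eq_suminf G_def sT0)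
  ultimately show ?thesis by (simp add: R_def g_def)
qed

section \<open>Closed form of the cost\<close>

text \<open>Entering a child shifts all depths by one and halves all weights, which matches the
  recursions of \<open>label_mass\<close> and \<open>mean_depth\<close>.\<close>

lemma leaf_count_sums:
  assumes "no_back t" "finite I" "\<forall>i d. i \<notin> I \<or> N < d \<longrightarrow> leaf_count t i d = 0"
  shows "(\<Sum>d\<le>N. real (leaf_count t i d) / 2 ^ d) = label_mass i t"
    and "(\<Sum>i\<in>I. \<Sum>d\<le>N. real d * real (leaf_count t i d) / 2 ^ d) = mean_depth t"
proof -
  \<comment> \<open>The vanishing count at \<open>Suc N\<close> allows one more zero term, so that
    the shifted sum again ends at \<open>N\<close>.\<close>
  have shift: "(\<Sum>d\<le>N. f d * real (leaf_count (Node l r) i d) / 2 ^ d)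
      = (\<Sum>d\<le>N. f (Suc d) * real (leaf_count l i d) / 2 ^ d) / 2
        + (\<Sum>d\<le>N. f (Suc d) * real (leaf_count r i d) / 2 ^ d) / 2"
    if "leaf_count (Node l r) i (Suc N) = 0" for f :: "nat \<Rightarrow> real" and l r i
  proof -
    have "(\<Sum>d\<le>N. f d * real (leaf_count (Node l r) i d) / 2 ^ d)
        = (\<Sum>d\<le>Suc N. f d * real (leaf_count (Node l r) i d) / 2 ^ d)"
      using that by simp
    also have "\<dots> = (\<Sum>d\<le>N. f (Suc d) * real (leaf_count (Node l r) i (Suc d)) / 2 ^ Suc d)"
      by (subst sum.atMost_Suc_shift) simp
    finally show ?thesis
      by (simp add: sum_divide_distrib sum.distrib[symmetric] field_simps)
  qed
  have child: "leaf_count l i d = 0" "leaf_count r i d = 0"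
    if "\<forall>i d. i \<notin> I \<or> N < d \<longrightarrow> leaf_count (Node l r) i d = 0" "i \<notin> I \<or> N < d" for l r i d
    using that(1)[rule_format, of i "Suc d"] that(2) by auto
  have mass: "(\<Sum>d\<le>N. real (leaf_count t i d) / 2 ^ d) = label_mass i t"
    if "no_back t" "\<forall>i d. i \<notin> I \<or> N < d \<longrightarrow> leaf_count t i d = 0" for t i
    using that
  proof (induction t)
    case (Leaf j)
    have "(\<Sum>d\<le>N. real (leaf_count (Leaf j) i d) / 2 ^ d) = (\<Sum>d\<le>N. if d = 0 then of_bool (i = j) else 0)"
      by (intro sum.cong) auto
    then show ?case by simp
  next
    case (Node l r)
    have "leaf_count (Node l r) i (Suc N) = 0" using Node.prems(2) by blast
    with Node show ?case
      using shift[of l r i "\<lambda>_. 1"] child[OF Node.prems(2)] by simp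
  qed simp
  \<comment> \<open>Without back edges every descent ends at some label; the total mass 1 is the
    amount by which one more level raises the mean depth.\<close>
  have one: "(\<Sum>i\<in>I. label_mass i t) = 1"
    if "no_back t" "\<forall>i d. i \<notin> I \<or> N < d \<longrightarrow> leaf_count t i d = 0" for t
    using that
  proof (induction t)
    case (Leaf j)
    then have "j \<in> I" by (metis leaf_count.simps(1) zero_neq_one)
    then show ?case using assms(2) by simp
  next
    case (Node l r)
    then show ?case
      using child[OF Node.prems(2)] by (simp add: sum.distrib sum_divide_distrib[symmetric])
  qed simp
  show "(\<Sum>d\<le>N. real (leaf_count t i d) / 2 ^ d) = label_mass i t"
    using mass[OF assms(1,3)] by blast
  show "(\<Sum>i\<in>I. \<Sum>d\<le>N. real d * real (leaf_count t i d) / 2 ^ d) = mean_depth t"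
    using assms(1,3)
  proof (induction t)
    case (Leaf j)
    show ?case by (auto intro!: sum.neutral)
  next
    case (Node l r)
    define F where "F u = (\<Sum>i\<in>I. \<Sum>d\<le>N. real d * real (leaf_count u i d) / 2 ^ d)" for u
    have sub: "no_back l" "no_back r" using Node.prems by auto
    have split: "(\<Sum>i\<in>I. \<Sum>d\<le>N. real (Suc d) * real (leaf_count u i d) / 2 ^ d) = 1 + F u"
      if "no_back u" "\<forall>i d. i \<notin> I \<or> N < d \<longrightarrow> leaf_count u i d = 0" for u
    proof -
      have "(\<Sum>d\<le>N. real (Suc d) * real (leaf_count u i d) / 2 ^ d)
          = label_mass i u + (\<Sum>d\<le>N. real d * real (leaf_count u i d) / 2 ^ d)" for i
        unfolding mass[OF that, symmetric] sum.distrib[symmetric]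
        by (intro sum.cong refl) (simp add: distrib_right add_divide_distrib)
      then show ?thesis using one[OF that] by (simp add: F_def sum.distrib)
    qed
    have "F (Node l r) = (\<Sum>i\<in>I. \<Sum>d\<le>N. real (Suc d) * real (leaf_count l i d) / 2 ^ d) / 2
        + (\<Sum>i\<in>I. \<Sum>d\<le>N. real (Suc d) * real (leaf_count r i d) / 2 ^ d) / 2"
      unfolding F_def sum_divide_distrib[of _ I] sum.distrib[symmetric]
      using Node.prems(2) by (intro sum.cong refl shift) blast
    also have "\<dots> = (1 + F l) / 2 + (1 + F r) / 2"
      using split sub child[OF Node.prems(2)] by simp
    also have "F l = mean_depth l" unfolding F_def
      using Node.IH(1)[OF sub(1)] child[OF Node.prems(2)] by blast
    also have "F r = mean_depth r" unfolding F_def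
      using Node.IH(2)[OF sub(2)] child[OF Node.prems(2)] by blast
    finally show ?case by (simp add: F_def field_simps)
  qed simp
qed

text \<open>Depth \<open>d\<close> belongs to digit position \<open>j = K - d\<close>, and the sum
  of \<open>(K - j) * x_j * 2 ^ j\<close> is \<open>K * x - bit_moment x\<close>.\<close>

lemma bit_moment_real_sum:
  assumes "x \<le> 2 ^ K"
  shows "(\<Sum>d\<le>K. real d * of_bool (bit x (K - d)) / 2 ^ d) = (real K * real x - real (bit_moment x)) / 2 ^ K"
    and "(\<Sum>d\<le>K. of_bool (bit x (K - d)) / 2 ^ d) = real x / 2 ^ K"
proof -
  \<comment> \<open>The value \<open>2 ^ K\<close> itself is allowed; its digit at position
    \<open>K\<close> is a leaf at depth 0.\<close>
  have x: "x < 2 ^ Suc K" using assms by (simp add: le_less_trans)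
  have rx: "real x = (\<Sum>j\<le>K. of_bool (bit x j) * 2 ^ j)"
  proof -
    have "x = (\<Sum>j\<le>K. of_bool (bit x j) * 2 ^ j)"
      using x by (simp only: digit_sum mod_less)
    then have "real x = real (\<Sum>j\<le>K. of_bool (bit x j) * 2 ^ j)" by metis
    then show ?thesis by simp
  qed
  have rev: "(\<Sum>d\<le>K. f d * of_bool (bit x (K - d)) / 2 ^ d)
      = (\<Sum>j\<le>K. f (K - j) * (of_bool (bit x j) * 2 ^ j)) / 2 ^ K" for f :: "nat \<Rightarrow> real"
    unfolding sum_divide_distrib
    by (rule sum.reindex_bij_witness[of _ "\<lambda>j. K - j" "\<lambda>d. K - d"])
      (auto simp: field_simps power_add[symmetric])
  show "(\<Sum>d\<le>K. of_bool (bit x (K - d)) / 2 ^ d) = real x / 2 ^ K"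
    using rev[of "\<lambda>_. 1"] rx by simp
  have "real (bit_moment x) = (\<Sum>j\<le>K. real j * (of_bool (bit x j) * 2 ^ j))"
    unfolding bit_moment_eq_sum[OF x] lessThan_Suc_atMost by (simp add: mult.assoc)
  moreover have "(\<Sum>j\<le>K. real (K - j) * (of_bool (bit x j) * 2 ^ j))
      = real K * (\<Sum>j\<le>K. of_bool (bit x j) * 2 ^ j) - (\<Sum>j\<le>K. real j * (of_bool (bit x j) * 2 ^ j))"
    unfolding sum_distrib_left sum_subtractf[symmetric]
    by (intro sum.cong refl) (auto simp: algebra_simps of_nat_diff)
  ultimately show "(\<Sum>d\<le>K. real d * of_bool (bit x (K - d)) / 2 ^ d)
      = (real K * real x - real (bit_moment x)) / 2 ^ K"
    using rev[of real] rx by simp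
qed

lemma sum_fldr_weight:
  assumes "0 < (\<Sum>j=1..n. A j)"
  shows "(\<Sum>i\<le>n. fldr_weight n A i) = 2 ^ ceil_log (\<Sum>j=1..n. A j)"
proof -
  have "(\<Sum>i\<le>n. fldr_weight n A i) = fldr_weight n A 0 + (\<Sum>i=1..n. fldr_weight n A i)"
    by (simp only: atMost_atLeast0 sum.atLeast_Suc_atMost[OF le0] One_nat_def)
  also have "(\<Sum>i=1..n. fldr_weight n A i) = (\<Sum>i=1..n. A i)"
    by (intro sum.cong) (auto simp: fldr_weight_def)
  finally show ?thesis
    using ceil_log_ge[OF assms] by (simp add: fldr_weight_def Let_def)
qed

text \<open>The mean depth is the numerator over \<open>2 ^ K\<close>, and a descent is accepted
  with probability \<open>M / 2 ^ K\<close>. Nonnegativity of the numerator matters because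
  \<open>ennreal\<close> sends all negative reals to 0.\<close>

lemma expected_cost_fldr:
  assumes "is_fldr n A T" and M: "M = (\<Sum>j=1..n. A j)" "0 < M" and K: "K = ceil_log M"
  shows "real (\<Sum>i\<le>n. bit_moment (fldr_weight n A i)) \<le> real K * 2 ^ K"
    and "expected_cost T
      = ennreal ((real K * 2 ^ K - real (\<Sum>i\<le>n. bit_moment (fldr_weight n A i))) / real M)"
proof -
  define w where "w = fldr_weight n A"
  obtain T0 where T0: "no_back T0" "T = reject_to_root T0"
    and opt: "\<And>i d. int (leaf_count T0 i d) = eps (int d) (fldr_dist n A i)"
    using assms(1) by (auto simp: is_fldr_def entropy_optimal_def)
  have lc: "leaf_count T0 i d = (if d \<le> K then of_bool (bit (w i) (K - d)) else 0)" for i d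
    using opt[of i d] unfolding fldr_dist_def eps_dyadic
    by (auto simp: w_def K M split: if_splits)
  have sumw: "(\<Sum>i\<le>n. w i) = 2 ^ K"
    using sum_fldr_weight M K by (simp add: w_def)
  have wle: "w i \<le> 2 ^ K" if "i \<le> n" for i
    using member_le_sum[of i "{..n}" w] that sumw by simp
  have w0: "real (w 0) = 2 ^ K - real M"
    unfolding w_def fldr_weight_def Let_def M(1)[symmetric] K[symmetric]
    using ceil_log_ge[OF M(2)] by (simp add: K of_nat_diff)
  have supp: "\<forall>i d. i \<notin> {..n} \<or> K < d \<longrightarrow> leaf_count T0 i d = 0"
    by (auto simp: lc w_def fldr_weight_def)
  note sums = leaf_count_sums[OF T0(1) finite_atMost supp]
  have "label_mass 0 T0 = (\<Sum>d\<le>K. of_bool (bit (w 0) (K - d)) / 2 ^ d)"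
    using sums(1)[of 0] by (simp add: lc)
  also have "\<dots> = real (w 0) / 2 ^ K"
    by (rule bit_moment_real_sum) (simp add: wle)
  finally have mass: "1 - label_mass 0 T0 = real M / 2 ^ K"
    by (simp add: w0 field_simps)
  have "mean_depth T0 = (\<Sum>i\<le>n. \<Sum>d\<le>K. real d * of_bool (bit (w i) (K - d)) / 2 ^ d)"
    using sums(2) by (simp add: lc)
  also have "\<dots> = (\<Sum>i\<le>n. (real K * real (w i) - real (bit_moment (w i))) / 2 ^ K)"
    using wle by (intro sum.cong bit_moment_real_sum) auto
  also have "\<dots> = (real K * real (\<Sum>i\<le>n. w i) - real (\<Sum>i\<le>n. bit_moment (w i))) / 2 ^ K"
    by (simp add: sum_divide_distrib sum_subtractf sum_distrib_left diff_divide_distrib)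
  also have "real (\<Sum>i\<le>n. w i) = 2 ^ K"
    by (simp only: sumw of_nat_power of_nat_numeral)
  finally have depth: "mean_depth T0
      = (real K * 2 ^ K - real (\<Sum>i\<le>n. bit_moment (w i))) / 2 ^ K" .
  show "real (\<Sum>i\<le>n. bit_moment (fldr_weight n A i)) \<le> real K * 2 ^ K"
    using mean_depth_nonneg[of T0] unfolding depth w_def by (simp add: field_simps)
  have "0 < real M / 2 ^ K" using M(2) by simp
  then have "label_mass 0 T0 < 1" unfolding mass[symmetric] by simp
  then show "expected_cost T
      = ennreal ((real K * 2 ^ K - real (\<Sum>i\<le>n. bit_moment (fldr_weight n A i))) / real M)"
    using expected_cost_reject_to_root[OF T0(1)] unfolding T0(2)
    by (simp add: mass depth w_def)
qed

section \<open>Comparison of the two costs\<close>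

lemma ceil_log_eqI:
  assumes "0 < M" "M \<le> 2 ^ K" "2 ^ K < 2 * M"
  shows "ceil_log M = K"
proof -
  have "real M \<le> real (2 ^ K)" using assms(2) by (simp only: of_nat_le_iff)
  then have "log 2 (real M) \<le> real K"
    using assms(1) by (simp add: log_le_iff powr_realpow)
  moreover have "real K - 1 < log 2 (real M)"
  proof -
    have "real (2 ^ K) < real (2 * M)" using assms(3) by (simp only: of_nat_less_iff)
    then have "2 powr (real K - 1) < real M"
      by (simp add: powr_diff powr_realpow)
    then show ?thesis using assms(1) by (simp add: less_log_iff)
  qed
  ultimately have "\<lceil>log 2 (real M)\<rceil> = int K" by (intro ceiling_unique) auto
  then show ?thesis by (simp add: ceil_log_def)
qed

lemma ceil_log_less:
  assumes "0 < M"
  shows "2 ^ ceil_log M < 2 * M"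
proof -
  have "0 \<le> log 2 (real M)" using assms by simp
  then have "real (ceil_log M) - 1 < log 2 (real M)"
    unfolding ceil_log_def by linarith
  then have "2 powr (real (ceil_log M) - 1) < real M"
    using assms by (simp add: less_log_iff)
  then have "real (2 ^ ceil_log M) < real (2 * M)"
    by (simp add: powr_diff powr_realpow)
  then show ?thesis by (simp only: of_nat_less_iff)
qed

theorem theorem5p16:
  fixes a :: "nat \<Rightarrow> nat" and n m k K c :: nat and S T :: ddg
  assumes pos: "\<And>i. i \<in> {1..n} \<Longrightarrow> 0 < a i"
    and gcd1: "Gcd (a ` {1..n}) = 1"
    and m: "m = (\<Sum>i=1..n. a i)"
    and k: "k = ceil_log m"
    and a0: "a 0 = 2 ^ k - m"
    and K: "k \<le> K"
    and c: "c = 2 ^ K div m"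
    and S: "is_aldr n a K S"
    and T: "is_fldr n a T"
  shows "expected_cost S \<le> expected_cost T \<and>
    (expected_cost S = expected_cost T \<longleftrightarrow> (\<forall>i\<in>{0..n}. \<not> carries c (a i)))"
proof -
  \<comment> \<open>The gcd of the empty set is 0.\<close>
  have "n \<noteq> 0" using gcd1 by (cases n) auto
  then have "a 1 \<le> m" unfolding m by (intro member_le_sum) auto
  with pos[of 1] \<open>n \<noteq> 0\<close> have m0: "0 < m" by auto
  have mk: "m \<le> 2 ^ k" "2 ^ k < 2 * m"
    using ceil_log_ge[OF m0] ceil_log_less[OF m0] by (auto simp: k)
  have "(2::nat) ^ k \<le> 2 ^ K" using K by simp
  then have "m \<le> 2 ^ K" using mk(1) by linarith
  then have c0: "0 < c" using m0 by (simp add: c div_greater_zero_iff)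
  have cm: "c * m \<le> 2 ^ K" by (simp add: c)
  \<comment> \<open>\<open>2 ^ K\<close> exceeds \<open>c * m\<close> by less than \<open>m\<close>,
    hence by less than \<open>c * m\<close>; so the total weight of the ALDR tree is exactly
    \<open>2 ^ K\<close>.\<close>
  have "2 ^ K < c * m + m"
    using mod_less_divisor[OF m0, of "2 ^ K"] div_mult_mod_eq[of "2 ^ K" m] unfolding c by linarith
  moreover have "m \<le> c * m" using c0 by simp
  ultimately have "2 ^ K < 2 * (c * m)" by linarith
  then have KL: "K = ceil_log (c * m)"
    using ceil_log_eqI[OF _ cm] m0 c0 by simp
  define h where "h = (\<Sum>i\<le>n. bit_moment (a i))"
  define h' where "h' = (\<Sum>i\<le>n. bit_moment (fldr_weight n (\<lambda>i. c * a i) i))"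
  \<comment> \<open>The total surplus due to carries; by \<open>bit_moment_mult(1)\<close> no
    subtraction truncates.\<close>
  define D where "D = (\<Sum>i\<le>n. bit_moment (c * a i) - (c * bit_moment (a i) + a i * bit_moment c))"
  have sum0: "(\<Sum>i\<le>n. f i) = f 0 + (\<Sum>i=1..n. f i)" for f :: "nat \<Rightarrow> nat"
    by (simp only: atMost_atLeast0 sum.atLeast_Suc_atMost[OF le0] One_nat_def)
  have "fldr_weight n a i = a i" if "i \<le> n" for i
    unfolding fldr_weight_def Let_def m[symmetric] k[symmetric] using that a0 by simp
  then have "(\<Sum>i\<le>n. bit_moment (fldr_weight n a i)) = h"
    unfolding h_def by (intro sum.cong) auto
  with expected_cost_fldr[OF T m m0 k]
  have ET: "real h \<le> real k * 2 ^ k" "expected_cost T = ennreal ((real k * 2 ^ k - real h) / real m)"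
    by auto
  have M: "c * m = (\<Sum>j=1..n. c * a j)" by (simp add: m sum_distrib_left)
  have "is_fldr n (\<lambda>i. c * a i) S" using S by (simp add: is_aldr_def c m)
  from expected_cost_fldr[OF this M _ KL] m0 c0
  have ES: "real h' \<le> real K * 2 ^ K"
    "expected_cost S = ennreal ((real K * 2 ^ K - real h') / real (c * m))"
    by (simp_all add: h'_def)
  have suma: "(\<Sum>i\<le>n. a i) = 2 ^ k"
    unfolding sum0 a0 m[symmetric] using mk(1) by simp
  have "(\<Sum>i=1..n. bit_moment (fldr_weight n (\<lambda>i. c * a i) i)) = (\<Sum>i=1..n. bit_moment (c * a i))"
    by (intro sum.cong) (auto simp: fldr_weight_def)
  then have h'_eq: "h' = bit_moment (2 ^ K - c * m) + (\<Sum>i=1..n. bit_moment (c * a i))"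
    unfolding h'_def sum0 fldr_weight_def[of _ _ 0] Let_def M[symmetric] KL[symmetric] by simp
  have "D + (\<Sum>i\<le>n. c * bit_moment (a i) + a i * bit_moment c) = (\<Sum>i\<le>n. bit_moment (c * a i))"
    unfolding D_def sum.distrib[symmetric] by (intro sum.cong refl) (simp add: bit_moment_mult(1))
  then have "D + c * h + 2 ^ k * bit_moment c = bit_moment (c * a 0) + (\<Sum>i=1..n. bit_moment (c * a i))"
    unfolding sum.distrib sum_distrib_left[symmetric] sum_distrib_right[symmetric] suma h_def
      sum0[of "\<lambda>i. bit_moment (c * a i)"] by simp
  \<comment> \<open>ALDR rejects with weight \<open>2 ^ K - c * m\<close> instead of
    \<open>c * a 0\<close>; the exchange cancels the terms in \<open>bit_moment c\<close>, which
    were collected with factor \<open>2 ^ k\<close>, the sum of all \<open>a i\<close>.\<close>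
  moreover have "2 ^ K * K + bit_moment (c * a 0)
      = 2 ^ k * (bit_moment c + k * c) + bit_moment (2 ^ K - c * m)"
    unfolding a0 by (rule rejection_weight_bit_moment[OF m0 mk K c])
  ultimately have "2 ^ K * K + D + c * h = c * (2 ^ k * k) + h'"
    unfolding h'_eq by (simp add: algebra_simps)
  then have "real (2 ^ K * K + D + c * h) = real (c * (2 ^ k * k) + h')" by metis
  then have diff: "real K * 2 ^ K - real h' = real c * (real k * 2 ^ k - real h) - real D"
    by (simp add: algebra_simps)
  have quot: "(real K * 2 ^ K - real h') / real (c * m)
      = (real k * 2 ^ k - real h) / real m - real D / real (c * m)"
    unfolding diff using m0 c0 by (simp add: field_simps)
  have "expected_cost S \<le> expected_cost T"
    unfolding ET(2) ES(2) by (rule ennreal_leI) (unfold quot, simp)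
  \<comment> \<open>Both numerators are nonnegative, so \<open>ennreal\<close> is injective here and
    the gap \<open>D / (c * m)\<close> decides.\<close>
  moreover have "expected_cost S = expected_cost T \<longleftrightarrow> D = 0"
    unfolding ET(2) ES(2) using ET(1) ES(1) m0 c0
    by (subst ennreal_inj) (simp, simp, unfold quot, simp)
  moreover have "D = 0 \<longleftrightarrow> (\<forall>i\<in>{0..n}. \<not> carries c (a i))"
    using bit_moment_mult(1)[of c] unfolding D_def bit_moment_mult(2)[symmetric]
    by (auto simp: le_antisym)
  ultimately show ?thesis by blast
qed

end
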